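(* There is an upper triangular semi-infinite matrix $\mathbf{R}$ such that the square of the positive definite symmetric matrix $\mathbf{J}_{[2]}-c\mathbf{I}$ has the factorization $$(\mathbf{J}_{[2]}-c\mathbf{I})^2=\mathbf{R}\mathbf{R}^\intercal,$$ and, furthermore, $$(\mathbf{J}-c\mathbf{I})^2=\mathbf{R}^\intercal\mathbf{R}.$$
   Context: $\mu$ is a positive Borel measure with infinite support contained in an interval $E\subseteq\mathbb{R}$ (bounded or unbounded), with all moments finite, and $c\in\mathbb{R}\setminus E$ lies to the left of $E$. $\bar{\mathbf{p}}=[p_0,p_1,\dots]^\intercal$ and $\bar{\mathbf{p}}^{[2]}=[p_0^{[2]},p_1^{[2]},\dots]^\intercal$ are the vectors of orthonormal polynomials (positive leading coefficients) with respect to $d\mu$ and $(x-c)^2d\mu$ respectively; $\mathbf{J}$ and $\mathbf{J}_{[2]}$ are the semi-infinite symmetric tridiagonal (Jacobi) matrices with $x\bar{\mathbf{p}}=\mathbf{J}\bar{\mathbf{p}}$ and $x\bar{\mathbf{p}}^{[2]}=\mathbf{J}_{[2]}\bar{\mathbf{p}}^{[2]}$. $\mathbf{I}$ is the identity matrix. *)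

theory Defs
  imports "HOL-Analysis.Analysis" "HOL-Computational_Algebra.Polynomial"
begin

definition msupport :: "real measure \<Rightarrow> real set" where
  "msupport M = {x. \<forall>U. open U \<and> x \<in> U \<longrightarrow> emeasure M U > 0}"

definition finite_moments :: "real measure \<Rightarrow> bool" where
  "finite_moments M \<longleftrightarrow> (\<forall>n::nat. integrable M (\<lambda>x. x ^ n))"

definition orthonormal_polys :: "real measure \<Rightarrow> (nat \<Rightarrow> real poly) \<Rightarrow> bool" where
  "orthonormal_polys M p \<longleftrightarrow>
     (\<forall>n. degree (p n) = n \<and> lead_coeff (p n) > 0) \<and>
     (\<forall>m n. (\<integral>x. poly (p m) x * poly (p n) x \<partial>M) = (if m = n then 1 else 0))"

type_synonym semi_mat = "nat \<Rightarrow> nat \<Rightarrow> real"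

definition semi_transpose :: "semi_mat \<Rightarrow> semi_mat" where
  "semi_transpose A = (\<lambda>i j. A j i)"

(* The infinite sum is 0 when it does not converge, so equations between products of
   matrices that are not banded are to be read together with semi_mult_defined. *)
definition semi_mult :: "semi_mat \<Rightarrow> semi_mat \<Rightarrow> semi_mat" where
  "semi_mult A B = (\<lambda>i j. \<Sum>\<^sub>\<infinity>k. A i k * B k j)"

definition semi_mult_defined :: "semi_mat \<Rightarrow> semi_mat \<Rightarrow> bool" where
  "semi_mult_defined A B \<longleftrightarrow> (\<forall>i j. (\<lambda>k. A i k * B k j) summable_on UNIV)"

definition semi_shift :: "semi_mat \<Rightarrow> real \<Rightarrow> semi_mat" where
  "semi_shift A c = (\<lambda>i j. A i j - c * (if i = j then 1 else 0))"

definition semi_symmetric :: "semi_mat \<Rightarrow> bool" where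
  "semi_symmetric A \<longleftrightarrow> semi_transpose A = A"

definition semi_tridiagonal :: "semi_mat \<Rightarrow> bool" where
  "semi_tridiagonal A \<longleftrightarrow> (\<forall>i j. i > Suc j \<or> j > Suc i \<longrightarrow> A i j = 0)"

definition semi_upper_triangular :: "semi_mat \<Rightarrow> bool" where
  "semi_upper_triangular A \<longleftrightarrow> (\<forall>i j. j < i \<longrightarrow> A i j = 0)"

(* Positivity of the quadratic form on nonzero finitely supported vectors, i.e. positive
   definiteness of every leading principal truncation. *)
definition semi_pos_def :: "semi_mat \<Rightarrow> bool" where
  "semi_pos_def A \<longleftrightarrow>
     (\<forall>N v. (\<exists>i<N. v i \<noteq> 0) \<longrightarrow> (\<Sum>i<N. \<Sum>j<N. v i * A i j * v j) > 0)"

definition jacobi_matrix :: "(nat \<Rightarrow> real poly) \<Rightarrow> semi_mat \<Rightarrow> bool" where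
  "jacobi_matrix p J \<longleftrightarrow> semi_symmetric J \<and> semi_tridiagonal J \<and>
     (\<forall>n x. ((\<lambda>k. J n k * poly (p k) x) has_sum x * poly (p n) x) UNIV)"

end

(*
  Write <q, r> for the integral of q r. The matrix R with entries
  R k n = <p2 k, p n> with respect to (x - c)^2 d\<mu> is upper triangular, since p2 k is
  orthogonal to all polynomials of smaller degree. All the matrix entries involved are inner
  products, and each of the four matrix products is evaluated by Parseval's identity in one of
  the two orthonormal systems: both sides of the first factorization have entries
  <(x - c) p2 i, (x - c) p2 j> with respect to (x - c)^2 d\<mu>, both sides of the second have
  entries <(x - c) p i, (x - c) p j> with respect to d\<mu>.
  Positive definiteness: the quadratic form of J2 - c I at v is the integral of
  (x - c)^3 q(x)^2 d\<mu> with q = sum of v i p2 i, and x > c almost everywhere.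
*)

theory Submission imports Defs begin

section \<open>Inner products of polynomials\<close>

text \<open>The product is formed inside \<open>poly\<close>, so symmetry and moving a factor from
  one argument to the other are ring identities.\<close>

definition poly_inner :: "real measure \<Rightarrow> real poly \<Rightarrow> real poly \<Rightarrow> real" where
  "poly_inner M q r = (\<integral>x. poly (q * r) x \<partial>M)"

lemma integrable_poly:
  assumes "finite_moments M"
  shows "integrable M (poly q)"
proof -
  have "integrable M (\<lambda>x. \<Sum>i\<le>degree q. coeff q i * x ^ i)"
    using assms by (intro Bochner_Integration.integrable_sum integrable_mult_right)
      (auto simp: finite_moments_def)
  then show ?thesis
    by (simp add: poly_altdef[abs_def])
qed

lemma poly_inner_commute: "poly_inner M q r = poly_inner M r q"
  by (simp add: poly_inner_def mult.commute)

lemma poly_inner_mult_left: "poly_inner M (l * q) r = poly_inner M q (l * r)"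
  by (simp add: poly_inner_def mult_ac)

lemma poly_inner_smult_left: "poly_inner M (smult a q) r = a * poly_inner M q r"
  by (simp add: poly_inner_def mult.assoc)

lemma poly_inner_smult_right: "poly_inner M q (smult a r) = a * poly_inner M q r"
  by (metis poly_inner_smult_left poly_inner_commute)

lemma poly_inner_add_left:
  assumes "finite_moments M"
  shows "poly_inner M (q + r) s = poly_inner M q s + poly_inner M r s"
  unfolding poly_inner_def distrib_right poly_add
  by (intro Bochner_Integration.integral_add integrable_poly assms)

lemma poly_inner_0_left [simp]: "poly_inner M 0 r = 0"
  by (simp add: poly_inner_def)

lemma poly_inner_sum_left:
  assumes "finite_moments M"
  shows "poly_inner M (\<Sum>k\<in>A. f k) r = (\<Sum>k\<in>A. poly_inner M (f k) r)"
  by (induction A rule: infinite_finite_induct) (simp_all add: poly_inner_add_left[OF assms])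

lemma poly_inner_sum_right:
  assumes "finite_moments M"
  shows "poly_inner M r (\<Sum>k\<in>A. f k) = (\<Sum>k\<in>A. poly_inner M r (f k))"
  using poly_inner_sum_left[OF assms] by (simp add: poly_inner_commute)

lemma orthonormal_polys_poly_inner:
  assumes "orthonormal_polys M p"
  shows "poly_inner M (p m) (p n) = (if m = n then 1 else 0)"
  using assms by (simp add: orthonormal_polys_def poly_inner_def)

section \<open>Expansions in orthonormal polynomials\<close>

text \<open>Induction on n: subtracting the multiple of \<open>p n\<close> that cancels the
  coefficient at n leaves a polynomial in the span of the earlier members.\<close>

lemma poly_expansion_by_degree:
  fixes p :: "nat \<Rightarrow> 'a :: field poly"
  assumes "\<And>n. degree (p n) = n" and "\<And>n. p n \<noteq> 0" and "degree q < n"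
  shows "\<exists>a. q = (\<Sum>k<n. smult (a k) (p k))"
  using assms(3)
proof (induction n arbitrary: q)
  case 0
  then show ?case by simp
next
  case (Suc n)
  define b where "b = coeff q n / coeff (p n) n"
  define r where "r = q - smult b (p n)"
  have "coeff (p n) n \<noteq> 0"
    by (metis assms(1,2) leading_coeff_0_iff)
  then have r_n: "coeff r n = 0"
    by (simp add: r_def b_def)
  have r_le: "degree r \<le> n"
    using Suc.prems assms(1)[of n] unfolding r_def
    by (intro degree_diff_le order.trans[OF degree_smult_le]) auto
  obtain a where a: "r = (\<Sum>k<n. smult (a k) (p k))"
  \<comment> \<open>For n = 0 no degree lies below n, so the remainder has to be 0; otherwise the
    vanishing coefficient at n pushes its degree strictly below n.\<close>
  proof (cases "n = 0")
    case True
    then have "r = 0"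
      using r_le r_n by (metis degree_0_id le_zero_eq of_nat_0 leading_coeff_0_iff)
    then show ?thesis
      using True that by simp
  next
    case False
    then have "degree r < n"
      using r_le r_n by (metis le_neq_implies_less leading_coeff_0_iff degree_0)
    then show ?thesis
      using Suc.IH that by blast
  qed
  have "q = (\<Sum>k<Suc n. smult ((a(n := b)) k) (p k))"
    using a by (simp add: r_def algebra_simps)
  then show ?case
    by blast
qed

text \<open>Pairing any expansion in the basis with \<open>p k\<close> isolates its k-th
  coefficient.\<close>

lemma orthonormal_polys_expansion:
  assumes "finite_moments M" and p: "orthonormal_polys M p" and "degree q < n"
  shows "q = (\<Sum>k<n. smult (poly_inner M q (p k)) (p k))"
proof -
  have "degree (p k) = k" "lead_coeff (p k) > 0" for k
    using p unfolding orthonormal_polys_def by blast+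
  then have "degree (p k) = k" "p k \<noteq> 0" for k
    by (metis less_irrefl leading_coeff_0_iff)+
  then obtain a where a: "q = (\<Sum>k<n. smult (a k) (p k))"
    using poly_expansion_by_degree assms(3) by blast
  have "poly_inner M q (p k) = a k" if "k < n" for k
    using that unfolding a
    by (simp add: poly_inner_sum_left[OF assms(1)] poly_inner_smult_left
        orthonormal_polys_poly_inner[OF p] if_distrib cong: if_cong)
  then show ?thesis
    using a by simp
qed

lemma orthonormal_polys_inner_eq_0:
  assumes "finite_moments M" and p: "orthonormal_polys M p" and "degree q < n"
  shows "poly_inner M q (p n) = 0"
proof -
  have "poly_inner M q (p n)
      = poly_inner M (\<Sum>k<n. smult (poly_inner M q (p k)) (p k)) (p n)"
    using orthonormal_polys_expansion[OF assms] by simp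
  also have "\<dots> = 0"
    by (simp add: poly_inner_sum_left[OF assms(1)] poly_inner_smult_left
        orthonormal_polys_poly_inner[OF p])
  finally show ?thesis .
qed

text \<open>The series is a finite sum: its terms vanish for k > \<open>degree q\<close>, and the
  rest is the expansion of q paired with r.\<close>

lemma orthonormal_polys_Parseval:
  assumes "finite_moments M" and "orthonormal_polys M p"
  shows "((\<lambda>k. poly_inner M q (p k) * poly_inner M (p k) r) has_sum poly_inner M q r) UNIV"
proof -
  let ?n = "Suc (degree q)"
  have "poly_inner M q r
      = poly_inner M (\<Sum>k<?n. smult (poly_inner M q (p k)) (p k)) r"
    using orthonormal_polys_expansion[OF assms, of q ?n] by simp
  also have "\<dots> = (\<Sum>k<?n. poly_inner M q (p k) * poly_inner M (p k) r)"
    by (simp only: poly_inner_sum_left[OF assms(1)] poly_inner_smult_left)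
  finally show ?thesis
    by (intro has_sum_finite_neutralI[of "{..<?n}"])
      (auto simp: orthonormal_polys_inner_eq_0[OF assms])
qed

section \<open>Jacobi matrices and their shifted squares\<close>

text \<open>Tridiagonality turns the pointwise recurrence into a polynomial identity, and pairing it
  with \<open>p j\<close> picks out one entry.\<close>

lemma jacobi_matrix_eq_poly_inner:
  assumes M: "finite_moments M" and p: "orthonormal_polys M p" and J: "jacobi_matrix p J"
  shows "J i j = poly_inner M ([:0, 1:] * p i) (p j)"
proof -
  \<comment> \<open>Large enough to cover i + 1, the last index where row i can be nonzero, and also
    the index j used in the pairing.\<close>
  let ?n = "i + j + 2"
  have "[:0, 1:] * p i = (\<Sum>k<?n. smult (J i k) (p k))"
  proof (rule poly_ext)
    fix x
    have "((\<lambda>k. J i k * poly (p k) x) has_sum x * poly (p i) x) UNIV"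
      using J by (simp add: jacobi_matrix_def)
    moreover have "((\<lambda>k. J i k * poly (p k) x) has_sum (\<Sum>k<?n. J i k * poly (p k) x)) UNIV"
      using J by (intro has_sum_finite_neutralI[of "{..<?n}"])
        (auto simp: jacobi_matrix_def semi_tridiagonal_def)
    ultimately show "poly ([:0, 1:] * p i) x = poly (\<Sum>k<?n. smult (J i k) (p k)) x"
      by (simp add: poly_sum has_sum_unique)
  qed
  then show ?thesis
    by (simp add: poly_inner_sum_left[OF M] poly_inner_smult_left
        orthonormal_polys_poly_inner[OF p] if_distrib cong: if_cong
        del: sum.lessThan_Suc mult_pCons_left)
qed

lemma semi_shift_jacobi_eq_poly_inner:
  assumes "finite_moments M" and "orthonormal_polys M p" and "jacobi_matrix p J"
  shows "semi_shift J c i j = poly_inner M ([:- c, 1:] * p i) (p j)"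
proof -
  have "[:- c, 1:] * p i = [:0, 1:] * p i + smult (- c) (p i)"
    by simp
  then show ?thesis
    by (simp only: poly_inner_add_left[OF assms(1)] poly_inner_smult_left semi_shift_def
        jacobi_matrix_eq_poly_inner[OF assms] orthonormal_polys_poly_inner[OF assms(2)])
qed

text \<open>Multiplication by x - c is symmetric for the inner product, so it moves onto
  \<open>p j\<close> and the matrix product becomes a Parseval sum.\<close>

lemma semi_shift_jacobi_square:
  assumes "finite_moments M" and "orthonormal_polys M p" and "jacobi_matrix p J"
  shows "semi_mult (semi_shift J c) (semi_shift J c) i j
    = poly_inner M ([:- c, 1:] * p i) ([:- c, 1:] * p j)"
  \<comment> \<open>Fixing the right argument as \<open>p j\<close> restricts the move to the second
    factor of each term.\<close>
  unfolding semi_mult_def semi_shift_jacobi_eq_poly_inner[OF assms]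
    poly_inner_mult_left[of M _ "p _" "p j"]
  by (intro infsumI orthonormal_polys_Parseval assms)

text \<open>The complement of the support is a union of open null sets, and by Lindelof a countable
  subfamily already covers it.\<close>

lemma AE_in_msupport:
  assumes "sets M = sets borel"
  shows "AE x in M. x \<in> msupport M"
proof -
  let ?\<U> = "{U. open U \<and> emeasure M U = 0}"
  obtain \<V> where \<V>: "\<V> \<subseteq> ?\<U>" "countable \<V>" "\<Union>\<V> = \<Union>?\<U>"
    using Lindelof[of ?\<U>] by blast
  have "\<Union>\<V> \<in> null_sets M"
  proof (rule null_sets_UN'[of \<V> "\<lambda>U. U" M, simplified])
    show "countable \<V>" by fact
    show "U \<in> null_sets M" if "U \<in> \<V>" for U
      using that \<V>(1) assms by (auto simp: null_sets_def)
  qed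
  moreover have "{x \<in> space M. x \<notin> msupport M} \<subseteq> \<Union>\<V>"
    unfolding \<V>(3) by (auto simp: msupport_def not_gr_zero)
  ultimately show ?thesis
    by (rule AE_I')
qed

theorem proposition5:
  fixes \<mu> :: "real measure" and E :: "real set" and c :: real
    and p p2 :: "nat \<Rightarrow> real poly" and J J2 :: semi_mat
  assumes "sets \<mu> = sets borel"
    and "is_interval E"
    and "msupport \<mu> \<subseteq> E"
    and "infinite (msupport \<mu>)"
    and "finite_moments \<mu>"
    and "\<forall>x\<in>E. c < x"
    and "orthonormal_polys \<mu> p"
    and "orthonormal_polys (density \<mu> (\<lambda>x. ennreal ((x - c)\<^sup>2))) p2"
    and "jacobi_matrix p J"
    and "jacobi_matrix p2 J2"
  shows "semi_symmetric (semi_shift J2 c) \<and> semi_pos_def (semi_shift J2 c) \<and>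
    (\<exists>R. semi_upper_triangular R \<and>
       semi_mult_defined R (semi_transpose R) \<and>
       semi_mult (semi_shift J2 c) (semi_shift J2 c) = semi_mult R (semi_transpose R) \<and>
       semi_mult_defined (semi_transpose R) R \<and>
       semi_mult (semi_shift J c) (semi_shift J c) = semi_mult (semi_transpose R) R)"
proof -

  \<comment> \<open>The reweighted measure\<close>
  define \<nu> where "\<nu> = density \<mu> (\<lambda>x. ennreal ((x - c)\<^sup>2))"
  define l where "l = [:- c, 1:]"
  note \<mu> = \<open>finite_moments \<mu>\<close> and p = \<open>orthonormal_polys \<mu> p\<close>
  have p2: "orthonormal_polys \<nu> p2"
    using assms(8) by (simp add: \<nu>_def)
  have meas: "f \<in> borel_measurable \<mu>" if "f \<in> borel_measurable borel" for f :: "real \<Rightarrow> real"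
    using that by (simp add: measurable_cong_sets[OF assms(1) refl])
  have poly_meas: "poly q \<in> borel_measurable \<mu>" for q :: "real poly"
    by (intro meas borel_measurable_continuous_onI continuous_intros)
  have \<nu>: "finite_moments \<nu>"
    unfolding finite_moments_def
  proof
    fix n :: nat
    \<comment> \<open>The density is itself a polynomial, so the moments of \<nu> are
      \<mu>-integrals of polynomials.\<close>
    have "(\<lambda>x. (x - c)\<^sup>2 *\<^sub>R x ^ n) = poly (l\<^sup>2 * monom 1 n)"
      by (simp add: fun_eq_iff l_def poly_monom)
    then have "integrable \<mu> (\<lambda>x. (x - c)\<^sup>2 *\<^sub>R x ^ n)"
      by (simp only: integrable_poly[OF \<mu>])
    then show "integrable \<nu> (\<lambda>x. x ^ n)"
      unfolding \<nu>_def by (subst integrable_density) (auto intro!: meas)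
  qed
  have inner_\<nu>: "poly_inner \<nu> q r = poly_inner \<mu> (l\<^sup>2 * q) r" for q r
  proof -
    have "poly_inner \<nu> q r = (\<integral>x. (x - c)\<^sup>2 *\<^sub>R poly (q * r) x \<partial>\<mu>)"
      unfolding poly_inner_def \<nu>_def
      by (intro integral_density) (auto intro!: meas poly_meas)
    also have "\<dots> = poly_inner \<mu> (l\<^sup>2 * q) r"
      unfolding poly_inner_def
      by (intro Bochner_Integration.integral_cong) (simp_all add: l_def)
    finally show ?thesis .
  qed

  \<comment> \<open>The factor R and its two products\<close>
  \<comment> \<open>A connection matrix: column n holds the coefficients of \<open>p n\<close> in
    the basis \<open>p2\<close>, and row k those of \<open>l\<^sup>2 * p2 k\<close> in the basis
    \<open>p\<close>.\<close>
  define R where "R = (\<lambda>k n. poly_inner \<nu> (p2 k) (p n))"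
  have R\<mu>: "R k n = poly_inner \<mu> (l\<^sup>2 * p2 k) (p n)" for k n
    by (simp add: R_def inner_\<nu>)
  have "R i j = 0" if "j < i" for i j
    using orthonormal_polys_inner_eq_0[OF \<nu> p2, of "p j" i] that p
    by (simp add: R_def poly_inner_commute orthonormal_polys_def)
  then have R_upper: "semi_upper_triangular R"
    by (simp add: semi_upper_triangular_def)
  have RRt: "((\<lambda>k. R i k * semi_transpose R k j) has_sum
      poly_inner \<nu> (l * p2 i) (l * p2 j)) UNIV" for i j
  proof -
    have "((\<lambda>k. R i k * semi_transpose R k j) has_sum
        poly_inner \<mu> (l\<^sup>2 * p2 i) (l\<^sup>2 * p2 j)) UNIV"
      using orthonormal_polys_Parseval[OF \<mu> p, of "l\<^sup>2 * p2 i" "l\<^sup>2 * p2 j"]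
      by (simp only: semi_transpose_def R\<mu> poly_inner_commute[of \<mu> "l\<^sup>2 * p2 j"])
    \<comment> \<open>One factor \<open>l\<^sup>2\<close> is absorbed as the density of \<nu>; the
      other is shared between the two arguments.\<close>
    moreover have "poly_inner \<mu> (l\<^sup>2 * p2 i) (l\<^sup>2 * p2 j) = poly_inner \<nu> (l * p2 i) (l * p2 j)"
      unfolding inner_\<nu> unfolding poly_inner_def
      by (simp add: power2_eq_square mult_ac)
    ultimately show ?thesis by simp
  qed
  have RtR: "((\<lambda>k. semi_transpose R i k * R k j) has_sum
      poly_inner \<mu> (l * p i) (l * p j)) UNIV" for i j
  proof -
    have "((\<lambda>k. semi_transpose R i k * R k j) has_sum poly_inner \<nu> (p i) (p j)) UNIV"
      using orthonormal_polys_Parseval[OF \<nu> p2, of "p i" "p j"]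
      by (simp only: semi_transpose_def R_def poly_inner_commute[of \<nu> "p i" "p2 _"])
    moreover have "poly_inner \<nu> (p i) (p j) = poly_inner \<mu> (l * p i) (l * p j)"
      unfolding inner_\<nu> unfolding poly_inner_def
      by (simp add: power2_eq_square mult_ac)
    ultimately show ?thesis by simp
  qed

  \<comment> \<open>Symmetry and positive definiteness\<close>
  have J2_entry: "semi_shift J2 c i j = poly_inner \<nu> (l * p2 i) (p2 j)" for i j
    unfolding l_def by (rule semi_shift_jacobi_eq_poly_inner[OF \<nu> p2 assms(10)])
  have sym: "semi_symmetric (semi_shift J2 c)"
    using assms(10)
    by (auto simp: jacobi_matrix_def semi_symmetric_def semi_transpose_def semi_shift_def fun_eq_iff)
  have pos: "semi_pos_def (semi_shift J2 c)"
    unfolding semi_pos_def_def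
  proof (intro allI impI)
    fix N and v :: "nat \<Rightarrow> real"
    assume "\<exists>i<N. v i \<noteq> 0"
    then obtain i where i: "i < N" "v i \<noteq> 0" by blast
    define q where "q = (\<Sum>i<N. smult (v i) (p2 i))"
    have "poly_inner \<nu> (l * q) q
        = (\<Sum>j<N. \<Sum>i<N. v i * poly_inner \<nu> (l * p2 i) (p2 j) * v j)"
      unfolding q_def sum_distrib_left mult_smult_right
      by (simp add: poly_inner_sum_left[OF \<nu>] poly_inner_sum_right[OF \<nu>]
          poly_inner_smult_left poly_inner_smult_right sum_distrib_left mult_ac)
    then have form: "(\<Sum>i<N. \<Sum>j<N. v i * semi_shift J2 c i j * v j) = poly_inner \<nu> (l * q) q"
      unfolding J2_entry by (subst sum.swap) simp
    \<comment> \<open>This nonzero coefficient will witness that q does not vanish almost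
      everywhere.\<close>
    have "poly_inner \<nu> q (p2 i) = v i"
      using i by (simp add: q_def poly_inner_sum_left[OF \<nu>] poly_inner_smult_left
          orthonormal_polys_poly_inner[OF p2] if_distrib cong: if_cong)
    have gt: "AE x in \<mu>. c < x"
      using AE_in_msupport[OF assms(1)] assms(3,6) by auto
    \<comment> \<open>Two of the factors x - c come from the density, the third from the shifted
      matrix; the odd power is nonnegative because x > c almost everywhere.\<close>
    let ?f = "\<lambda>x. (x - c) ^ 3 * (poly q x)\<^sup>2"
    have f_eq: "?f = poly (l ^ 3 * q\<^sup>2)"
      by (simp add: fun_eq_iff l_def)
    have inner_eq: "poly_inner \<nu> (l * q) q = (\<integral>x. ?f x \<partial>\<mu>)"
      unfolding inner_\<nu> f_eq unfolding poly_inner_def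
      by (simp add: power2_eq_square power3_eq_cube mult_ac)
    have int: "integrable \<mu> ?f"
      unfolding f_eq by (rule integrable_poly[OF \<mu>])
    have nonneg: "AE x in \<mu>. 0 \<le> ?f x"
      using gt by eventually_elim simp
    have "(\<integral>x. ?f x \<partial>\<mu>) \<noteq> 0"
    proof
      assume "(\<integral>x. ?f x \<partial>\<mu>) = 0"
      then have "AE x in \<mu>. ?f x = 0"
        using integral_nonneg_eq_0_iff_AE[OF int nonneg] by simp
      then have "AE x in \<mu>. poly q x = 0"
        using gt by eventually_elim simp
      then have "AE x in \<mu>. poly (l\<^sup>2 * q * p2 i) x = 0"
        by eventually_elim simp
      then have "poly_inner \<nu> q (p2 i) = 0"
        unfolding inner_\<nu> unfolding poly_inner_def
        by (rule integral_eq_zero_AE)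
      then show False
        using i \<open>poly_inner \<nu> q (p2 i) = v i\<close> by simp
    qed
    moreover have "0 \<le> (\<integral>x. ?f x \<partial>\<mu>)"
      by (rule integral_nonneg_AE[OF nonneg])
    ultimately show "0 < (\<Sum>i<N. \<Sum>j<N. v i * semi_shift J2 c i j * v j)"
      by (simp add: form inner_eq)
  qed

  have "semi_mult (semi_shift J2 c) (semi_shift J2 c) = semi_mult R (semi_transpose R)"
    using infsumI[OF RRt] semi_shift_jacobi_square[OF \<nu> p2 assms(10)]
    by (simp add: fun_eq_iff semi_mult_def[of R] l_def)
  moreover have "semi_mult (semi_shift J c) (semi_shift J c) = semi_mult (semi_transpose R) R"
    using infsumI[OF RtR] semi_shift_jacobi_square[OF \<mu> p assms(9)]
    by (simp add: fun_eq_iff semi_mult_def[of "semi_transpose R"] l_def)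
  \<comment> \<open>Convergence of every entry rules out that the equalities rest on the default
    value 0 of \<open>semi_mult\<close>.\<close>
  moreover have "semi_mult_defined R (semi_transpose R)" "semi_mult_defined (semi_transpose R) R"
    unfolding semi_mult_defined_def using RRt RtR has_sum_imp_summable by blast+
  ultimately show ?thesis
    using sym pos R_upper by blast
qed

end
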